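(* Let $G$ be an abelian group and let $\varphi\in\mathrm{End}(G)$. The following conditions are equivalent: (i) $ns(\varphi)>0$; (ii) $ns(\varphi)=\infty$; (iii) $\mathrm{sc}(\varphi)\not\subseteq Q\mathrm{Per}(\varphi)$.
   Context: $\mathbb N=\{0,1,2,\dots\}$ and $\mathbb N_+=\mathbb N\setminus\{0\}$. Let $\lambda:\Gamma\to\Gamma$ be a self-map of a set $\Gamma$. A point $x\in\Gamma$ is quasi-periodic if $\lambda^n(x)=\lambda^m(x)$ for some $n<m$ in $\mathbb N$; $Q\mathrm{Per}(\lambda)$ is the set of quasi-periodic points. A string of $\lambda$ is a sequence $S=\{x_n\}_{n\in\mathbb N}$ of pairwise distinct elements of $\Gamma$ with $\lambda(x_n)=x_{n-1}$ for every $n\in\mathbb N_+$. A string is singular if $x_0\in Q\mathrm{Per}(\lambda)$, and non-singular otherwise. The non-singular string number is $ns(\lambda)=\sup\{|\mathcal F|:\mathcal F$ is a family of pairwise disjoint non-singular strings of $\lambda$ in $\Gamma\}$ (disjointness refers to the underlying sets of elements); it takes values in $\mathbb N\cup\{\infty\}$, i.e. it is set equal to $\infty$ whenever the supremum is infinite. The surjective core $\mathrm{sc}(\lambda)$ is the largest subset $\Lambda\subseteq\Gamma$ with $\lambda(\Lambda)=\Lambda$ (it always exists, and it is a subgroup when $\lambda$ is a group endomorphism). *)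

theory Defs
  imports "HOL-Algebra.Group" "HOL-Library.Extended_Nat" "HOL-Library.Disjoint_Sets"
begin

text \<open>
  A self-map of a set \<open>\<Gamma>\<close> is rendered as a function \<open>f\<close> together with the carrier
  set \<open>\<Gamma>\<close>, under the assumption \<open>f \<in> \<Gamma> \<rightarrow> \<Gamma>\<close>.  None of the notions below depends on
  the values of \<open>f\<close> outside \<open>\<Gamma>\<close>.
\<close>

definition QPer :: "'a set \<Rightarrow> ('a \<Rightarrow> 'a) \<Rightarrow> 'a set" where
  "QPer \<Gamma> f = {x \<in> \<Gamma>. \<exists>n m :: nat. n < m \<and> (f ^^ n) x = (f ^^ m) x}"

definition is_string :: "'a set \<Rightarrow> ('a \<Rightarrow> 'a) \<Rightarrow> (nat \<Rightarrow> 'a) \<Rightarrow> bool" where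
  "is_string \<Gamma> f S \<longleftrightarrow> range S \<subseteq> \<Gamma> \<and> inj S \<and> (\<forall>n. f (S (Suc n)) = S n)"

definition singular_string :: "'a set \<Rightarrow> ('a \<Rightarrow> 'a) \<Rightarrow> (nat \<Rightarrow> 'a) \<Rightarrow> bool" where
  "singular_string \<Gamma> f S \<longleftrightarrow> is_string \<Gamma> f S \<and> S 0 \<in> QPer \<Gamma> f"

definition nonsingular_string :: "'a set \<Rightarrow> ('a \<Rightarrow> 'a) \<Rightarrow> (nat \<Rightarrow> 'a) \<Rightarrow> bool" where
  "nonsingular_string \<Gamma> f S \<longleftrightarrow> is_string \<Gamma> f S \<and> S 0 \<notin> QPer \<Gamma> f"

text \<open>Cardinality without distinction between infinite cardinals.\<close>

definition ecard :: "'a set \<Rightarrow> enat" where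
  "ecard A = (if finite A then enat (card A) else \<infinity>)"

definition ns :: "'a set \<Rightarrow> ('a \<Rightarrow> 'a) \<Rightarrow> enat" where
  "ns \<Gamma> f = Sup {ecard F | F. (\<forall>S\<in>F. nonsingular_string \<Gamma> f S) \<and> disjoint_family_on range F}"

definition surj_core :: "'a set \<Rightarrow> ('a \<Rightarrow> 'a) \<Rightarrow> 'a set" where
  "surj_core \<Gamma> f = (GREATEST L. L \<subseteq> \<Gamma> \<and> f ` L = L)"

text \<open>The greatest such subset exists, so \<open>GREATEST\<close> is well defined here.\<close>

lemma surj_core_eq_Union: "surj_core \<Gamma> f = \<Union>{L. L \<subseteq> \<Gamma> \<and> f ` L = L}"
  unfolding surj_core_def
proof (rule Greatest_equality)
  have "f ` \<Union>{L. L \<subseteq> \<Gamma> \<and> f ` L = L} = (\<Union>L\<in>{L. L \<subseteq> \<Gamma> \<and> f ` L = L}. f ` L)"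
    by blast
  also have "\<dots> = \<Union>{L. L \<subseteq> \<Gamma> \<and> f ` L = L}"
    by simp
  finally show "\<Union>{L. L \<subseteq> \<Gamma> \<and> f ` L = L} \<subseteq> \<Gamma> \<and>
      f ` \<Union>{L. L \<subseteq> \<Gamma> \<and> f ` L = L} = \<Union>{L. L \<subseteq> \<Gamma> \<and> f ` L = L}"
    by blast
qed blast

lemma surj_core_subset: "surj_core \<Gamma> f \<subseteq> \<Gamma>"
  unfolding surj_core_eq_Union by blast

lemma image_surj_core: "f ` surj_core \<Gamma> f = surj_core \<Gamma> f"
proof -
  have "f ` surj_core \<Gamma> f = (\<Union>L\<in>{L. L \<subseteq> \<Gamma> \<and> f ` L = L}. f ` L)"
    unfolding surj_core_eq_Union by blast
  then show ?thesis
    unfolding surj_core_eq_Union by simp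
qed

lemma surj_core_greatest: "L \<subseteq> \<Gamma> \<Longrightarrow> f ` L = L \<Longrightarrow> L \<subseteq> surj_core \<Gamma> f"
  unfolding surj_core_eq_Union by blast

end

theory Submission
  imports Defs "HOL-Algebra.Generated_Groups"
begin

text \<open>
  A non-singular string is the same thing as a backward orbit, inside the surjective core, of a
  point that is not quasi-periodic.  So a non-singular string exists exactly when the core is not
  contained in the set \<open>Q\<close> of quasi-periodic points, and the real claim is that one point \<open>x\<close> of
  the core outside \<open>Q\<close> yields infinitely many disjoint strings.  Two strings that share an entry
  start at points whose forward orbits meet
  (\<open>ns_infinite_if_disjoint_orbits\<close>); hence it is enough to produce, from \<open>x\<close> and the group
  operations, infinitely many points of the core outside \<open>Q\<close> with pairwise disjoint forward orbits.
  In the following sketch the group is written additively.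

  Suppose that no positive multiple of \<open>x\<close> is in \<open>Q\<close>.  Then the points \<open>2\<^sup>a x\<close>, or else the
  points \<open>3\<^sup>a x\<close>, have disjoint forward orbits.  Indeed, a collision in either family says that some
  power of \<open>\<phi>\<close> acts on an iterate \<open>u\<close> of \<open>x\<close> like multiplication by the rational number
  \<open>2\<^sup>b\<^sup>-\<^sup>a\<close>, respectively \<open>3\<^sup>d\<^sup>-\<^sup>c\<close>, with non-zero exponent.
  Comparing the two actions on a common power of \<open>\<phi>\<close> gives a non-trivial relation \<open>M u = N u\<close>,
  by unique factorization, so a positive multiple of \<open>x\<close> has an iterate \<open>0\<close> and is in \<open>Q\<close>
  (\<open>ns_infinite_if_no_multiple_in_Q\<close>).

  Suppose instead that \<open>N x \<in> Q\<close> for some \<open>N > 0\<close>.  No iterate \<open>\<phi>\<^sup>d x\<close> lies in the subgroup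
  spanned by \<open>Q\<close> and the earlier iterates: otherwise that subgroup would contain the whole
  forward orbit, and, since it is finite modulo \<open>Q\<close>, the orbit would return to itself modulo
  \<open>Q\<close>, which forces \<open>x \<in> Q\<close> (\<open>Q_if_return_mod_Q\<close>).  This independence
  of the iterates makes the forward orbits of the points \<open>x + \<phi>\<^sup>k x\<close> with \<open>k > 0\<close> disjoint, because
  the two indices in an iterate of \<open>x + \<phi>\<^sup>k x\<close> can be read off from it
  (\<open>ns_infinite_if_multiple_in_Q\<close>).

  The implication from \<open>\<phi>\<^sup>m x - x \<in> Q\<close> to \<open>x \<in> Q\<close> does use that \<open>x\<close> is torsion modulo \<open>Q\<close>:
  for the shear \<open>(a, b) \<mapsto> (a + b, b)\<close> of \<open>\<int>\<^sup>2\<close>, which induces the identity modulo \<open>Q\<close>, the point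
  \<open>(0, 1)\<close> is not quasi-periodic.  This is why the torsion case and the other one need different
  families.
\<close>

section \<open>Strings and forward orbits of a self-map\<close>

lemma QPer_funpow_iff:
  assumes "f \<in> \<Gamma> \<rightarrow> \<Gamma>" and "x \<in> \<Gamma>"
  shows "(f ^^ k) x \<in> QPer \<Gamma> f \<longleftrightarrow> x \<in> QPer \<Gamma> f"
proof
  assume "(f ^^ k) x \<in> QPer \<Gamma> f"
  then obtain n m where "n < m" "(f ^^ n) ((f ^^ k) x) = (f ^^ m) ((f ^^ k) x)"
    unfolding QPer_def by blast
  then have "n + k < m + k" "(f ^^ (n + k)) x = (f ^^ (m + k)) x"
    by (simp_all add: funpow_add)
  with assms(2) show "x \<in> QPer \<Gamma> f"
    unfolding QPer_def by blast
next
  assume "x \<in> QPer \<Gamma> f"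
  then obtain n m where nm: "n < m" "(f ^^ n) x = (f ^^ m) x"
    unfolding QPer_def by blast
  have "(f ^^ n) ((f ^^ k) x) = (f ^^ m) ((f ^^ k) x)"
    using nm(2) by (metis add.commute comp_apply funpow_add)
  moreover have "(f ^^ k) x \<in> \<Gamma>"
    using assms by (induction k) auto
  ultimately show "(f ^^ k) x \<in> QPer \<Gamma> f"
    using nm(1) unfolding QPer_def by blast
qed

lemma funpow_chain:
  assumes "\<And>n. f (S (Suc n)) = S n"
  shows "(f ^^ k) (S (k + n)) = S n"
proof (induction k)
  case (Suc k)
  have "(f ^^ Suc k) (S (Suc k + n)) = (f ^^ k) (S (k + n))"
    by (simp add: funpow_swap1 assms)
  with Suc show ?case by simp
qed simp

text \<open>
  Two equal entries of a chain of preimages, pushed forward to its initial point, would make that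
  point periodic.
\<close>

lemma nonsingular_stringI:
  assumes "range S \<subseteq> \<Gamma>" and chain: "\<And>n. f (S (Suc n)) = S n" and "S 0 \<notin> QPer \<Gamma> f"
  shows "nonsingular_string \<Gamma> f S"
proof -
  have "S i \<noteq> S j" if "i < j" for i j
  proof
    assume eq: "S i = S j"
    have hit: "(f ^^ k) (S k) = S 0" for k
      using funpow_chain[of f S k 0] chain by simp
    have "(f ^^ (j - i)) (S 0) = (f ^^ (j - i + i)) (S i)"
      unfolding funpow_add by (simp add: hit)
    also have "\<dots> = S 0"
      using that eq hit[of j] by simp
    finally have "(f ^^ 0) (S 0) = (f ^^ (j - i)) (S 0)" by simp
    then show False
      using that assms(1,3) zero_less_diff[of j i] unfolding QPer_def by blast
  qed
  then have "inj S"
    by (metis injI linorder_neqE_nat)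
  with assms show ?thesis
    unfolding nonsingular_string_def is_string_def by blast
qed

text \<open>The core is its own image, so preimages can be chosen inside it forever.\<close>

lemma nonsingular_string_through:
  assumes "x \<in> surj_core \<Gamma> f" and "x \<notin> QPer \<Gamma> f"
  obtains S where "nonsingular_string \<Gamma> f S" and "S 0 = x"
proof -
  define S where "S = rec_nat x (\<lambda>_ y. SOME z. z \<in> surj_core \<Gamma> f \<and> f z = y)"
  have S0: "S 0 = x" unfolding S_def by simp
  have step: "S (Suc n) \<in> surj_core \<Gamma> f \<and> f (S (Suc n)) = S n" if "S n \<in> surj_core \<Gamma> f" for n
  proof -
    have "\<exists>z. z \<in> surj_core \<Gamma> f \<and> f z = S n"
      using that image_surj_core[of f \<Gamma>] by (metis image_iff)
    from someI_ex[OF this] show ?thesis unfolding S_def by simp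
  qed
  have mem: "S n \<in> surj_core \<Gamma> f" for n
    using assms(1) step by (induction n) (auto simp: S0)
  have "nonsingular_string \<Gamma> f S"
    using mem step surj_core_subset[of \<Gamma> f] assms(2) S0 by (intro nonsingular_stringI) auto
  with S0 that show ?thesis by blast
qed

text \<open>
  A string together with the forward orbit of its initial point is mapped onto itself, hence lies
  in the surjective core.
\<close>

lemma string_start_in_surj_core:
  assumes "f \<in> \<Gamma> \<rightarrow> \<Gamma>" and "is_string \<Gamma> f S"
  shows "S 0 \<in> surj_core \<Gamma> f"
proof -
  let ?L = "range S \<union> range (\<lambda>n. (f ^^ n) (S 0))"
  have S: "range S \<subseteq> \<Gamma>" "\<And>n. f (S (Suc n)) = S n"
    using assms(2) unfolding is_string_def by auto
  have "(f ^^ n) (S 0) \<in> \<Gamma>" for n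
    using S(1) assms(1) by (induction n) auto
  then have "?L \<subseteq> \<Gamma>" using S(1) by auto
  moreover have "f ` ?L = ?L"
  proof
    have "f (S n) \<in> ?L" for n
    proof (cases n)
      case 0
      have "f (S 0) = (f ^^ 1) (S 0)" by simp
      then show ?thesis using 0 by blast
    qed (simp add: S(2))
    moreover have "f ((f ^^ n) (S 0)) \<in> ?L" for n
      using rangeI[of "\<lambda>n. (f ^^ n) (S 0)" "Suc n"] by simp
    ultimately show "f ` ?L \<subseteq> ?L" by blast
    have str: "S n \<in> f ` ?L" for n
      using imageI[of "S (Suc n)" ?L f] by (simp add: S(2))
    moreover have "(f ^^ n) (S 0) \<in> f ` ?L" for n
    proof (cases n)
      case 0
      then show ?thesis using str[of 0] by simp
    next
      case (Suc m)
      then show ?thesis using imageI[of "(f ^^ m) (S 0)" ?L f] by simp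
    qed
    ultimately show "?L \<subseteq> f ` ?L" by blast
  qed
  ultimately show ?thesis
    using surj_core_greatest[of ?L \<Gamma> f] by blast
qed

lemma ns_pos_imp_core_not_QPer:
  assumes "f \<in> \<Gamma> \<rightarrow> \<Gamma>" and "ns \<Gamma> f > 0"
  shows "\<not> surj_core \<Gamma> f \<subseteq> QPer \<Gamma> f"
proof -
  obtain F where F: "\<forall>S\<in>F. nonsingular_string \<Gamma> f S" "0 < ecard F"
    using assms(2) unfolding ns_def less_Sup_iff by auto
  have "F \<noteq> {}"
    using F(2) unfolding ecard_def by (auto simp: zero_enat_def)
  with F(1) obtain S where "nonsingular_string \<Gamma> f S" by blast
  then show ?thesis
    using string_start_in_surj_core[OF assms(1)] unfolding nonsingular_string_def by blast
qed

text \<open>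
  If two strings share an entry, then the forward orbits of their initial points meet.  So instead
  of whole strings it suffices to separate forward orbits of points, where no choice of preimages
  is involved.
\<close>

lemma ns_infinite_if_disjoint_orbits:
  fixes z :: "nat \<Rightarrow> 'a"
  assumes core: "\<And>k. z k \<in> surj_core \<Gamma> f" and nper: "\<And>k. z k \<notin> QPer \<Gamma> f"
    and disj: "\<And>a b i j. a \<noteq> b \<Longrightarrow> (f ^^ i) (z a) \<noteq> (f ^^ j) (z b)"
  shows "ns \<Gamma> f = \<infinity>"
proof -
  have "\<exists>S. nonsingular_string \<Gamma> f S \<and> S 0 = z k" for k
    using nonsingular_string_through[OF core nper] by metis
  then obtain Z where Z: "\<And>k. nonsingular_string \<Gamma> f (Z k)" "\<And>k. Z k 0 = z k"
    by metis
  have hit: "(f ^^ n) (Z k n) = z k" for k n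
    using funpow_chain[of f "Z k" n 0] Z unfolding nonsingular_string_def is_string_def by simp
  have range_disj: "range (Z a) \<inter> range (Z b) = {}" if "a \<noteq> b" for a b
  proof -
    have False if "Z a n = Z b m" for n m
    proof -
      have "(f ^^ m) (z a) = (f ^^ (m + n)) (Z a n)"
        unfolding funpow_add by (simp add: hit)
      also have "\<dots> = (f ^^ (n + m)) (Z b m)"
        using that by (simp add: add.commute)
      also have "\<dots> = (f ^^ n) (z b)"
        unfolding funpow_add by (simp add: hit)
      finally show False using disj[OF \<open>a \<noteq> b\<close>] by blast
    qed
    then show ?thesis by blast
  qed
  have "inj Z"
  proof (rule injI)
    fix a b assume "Z a = Z b"
    then show "a = b" using range_disj[of a b] by fastforce
  qed
  then have "infinite (range Z)" by (simp add: finite_image_iff)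
  then have "ecard (range Z) = \<infinity>" unfolding ecard_def by simp
  moreover have "disjoint_family_on range (range Z)"
    unfolding disjoint_family_on_def by (metis imageE range_disj)
  moreover have "\<forall>S\<in>range Z. nonsingular_string \<Gamma> f S"
    using Z(1) by blast
  ultimately have "\<infinity> \<in> {ecard F | F. (\<forall>S\<in>F. nonsingular_string \<Gamma> f S) \<and> disjoint_family_on range F}"
    by (intro CollectI exI[of _ "range Z"]) simp
  then have "\<infinity> \<le> ns \<Gamma> f"
    unfolding ns_def by (rule Sup_upper)
  then show ?thesis by simp
qed


section \<open>Endomorphisms of abelian groups\<close>

lemma three_exponent_le:
  assumes "(2 :: nat) ^ u * 3 ^ v = 2 ^ u' * 3 ^ v'"
  shows "v \<le> v'"
proof (rule ccontr)
  assume "\<not> v \<le> v'"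
  then have "(3 :: nat) ^ Suc v' dvd 3 ^ v"
    by (intro le_imp_power_dvd) simp
  also have "(3 :: nat) ^ v dvd 2 ^ u' * 3 ^ v'"
    using assms by (metis dvd_triv_right)
  finally have "(3 :: nat) dvd 2 ^ u'"
    by simp
  moreover have "coprime (3 :: nat) 2"
    by (simp add: coprime_iff_gcd_eq_1 gcd_non_0_nat)
  then have "coprime (3 :: nat) (2 ^ u')"
    by simp
  ultimately show False
    using coprime_common_divisor_nat[of 3 "2 ^ u'" 3] by simp
qed

locale abelian_endomorphism = comm_group G for G :: "('a, 'b) monoid_scheme" (structure) +
  fixes \<phi> :: "'a \<Rightarrow> 'a"
  assumes endo: "\<phi> \<in> hom G G"
begin

abbreviation Q :: "'a set" where "Q \<equiv> QPer (carrier G) \<phi>"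

abbreviation core :: "'a set" where "core \<equiv> surj_core (carrier G) \<phi>"

lemma self_map: "\<phi> \<in> carrier G \<rightarrow> carrier G"
  using endo unfolding hom_def by auto

lemma iterate_group_hom: "group_hom G G (\<phi> ^^ n)"
proof (unfold_locales, induction n)
  case (Suc n)
  have "\<phi> \<circ> (\<phi> ^^ n) \<in> hom G G"
    using Group.hom_compose[OF Suc endo] .
  then show ?case by (simp add: comp_def)
qed (auto simp: hom_def)

lemmas iterate_simps [simp] =
  group_hom.hom_closed[OF iterate_group_hom] group_hom.hom_mult[OF iterate_group_hom]
  group_hom.hom_inv[OF iterate_group_hom] group_hom.hom_nat_pow[OF iterate_group_hom]
  group_hom.hom_one[OF iterate_group_hom] group_hom.hom_int_pow[OF iterate_group_hom]

lemma iterate_add: "(\<phi> ^^ m) ((\<phi> ^^ n) x) = (\<phi> ^^ (m + n)) x"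
  by (simp add: funpow_add)

lemma iterate_commute: "(\<phi> ^^ m) ((\<phi> ^^ n) x) = (\<phi> ^^ n) ((\<phi> ^^ m) x)"
  by (simp add: iterate_add add.commute)

lemma core_carrier: "x \<in> core \<Longrightarrow> x \<in> carrier G"
  by (rule subsetD[OF surj_core_subset])

lemma Q_carrier: "x \<in> Q \<Longrightarrow> x \<in> carrier G"
  unfolding QPer_def by blast

lemma iterate_in_Q_iff: "x \<in> carrier G \<Longrightarrow> (\<phi> ^^ k) x \<in> Q \<longleftrightarrow> x \<in> Q"
  using QPer_funpow_iff[OF self_map] .

lemma QI:
  assumes "x \<in> carrier G" and "0 < d" and "(\<phi> ^^ d) x = x"
  shows "x \<in> Q"
proof -
  have "0 < d \<and> (\<phi> ^^ 0) x = (\<phi> ^^ d) x"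
    using assms by simp
  with assms(1) show ?thesis unfolding QPer_def by blast
qed

lemma periodic_mult: "(\<phi> ^^ p) y = y \<Longrightarrow> (\<phi> ^^ (p * k)) y = y"
  by (induction k) (simp_all add: funpow_add)

text \<open>
  Finitely many iterates carry a quasi-periodic point into a cycle; pushing further and passing to
  a common multiple of the periods serves two points at once.
\<close>

lemma Q_common_period:
  assumes "x \<in> Q" and "y \<in> Q"
  obtains a p where "0 < p" and "(\<phi> ^^ p) ((\<phi> ^^ a) x) = (\<phi> ^^ a) x"
    and "(\<phi> ^^ p) ((\<phi> ^^ a) y) = (\<phi> ^^ a) y"
proof -
  have ev: "\<exists>a p. 0 < p \<and> (\<phi> ^^ p) ((\<phi> ^^ a) u) = (\<phi> ^^ a) u" if "u \<in> Q" for u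
  proof -
    obtain n m where nm: "n < m" "(\<phi> ^^ n) u = (\<phi> ^^ m) u"
      using \<open>u \<in> Q\<close> unfolding QPer_def by blast
    have "0 < m - n \<and> (\<phi> ^^ (m - n)) ((\<phi> ^^ n) u) = (\<phi> ^^ n) u"
      using nm(1) by (subst iterate_add) (simp add: nm(2))
    then show ?thesis by blast
  qed
  obtain a p where x: "0 < p" "(\<phi> ^^ p) ((\<phi> ^^ a) x) = (\<phi> ^^ a) x"
    using ev[OF assms(1)] by blast
  obtain b q where y: "0 < q" "(\<phi> ^^ q) ((\<phi> ^^ b) y) = (\<phi> ^^ b) y"
    using ev[OF assms(2)] by blast
  have "(\<phi> ^^ (p * q)) ((\<phi> ^^ (b + a)) x) = (\<phi> ^^ (b + a)) x"
    using arg_cong[OF periodic_mult[OF x(2), of q], of "\<phi> ^^ b"] by (simp add: iterate_add ac_simps)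
  moreover have "(\<phi> ^^ (p * q)) ((\<phi> ^^ (b + a)) y) = (\<phi> ^^ (b + a)) y"
    using arg_cong[OF periodic_mult[OF y(2), of p], of "\<phi> ^^ a"] by (simp add: iterate_add ac_simps)
  ultimately show ?thesis
    using that[of "p * q" "b + a"] x(1) y(1) by simp
qed

lemma subgroup_Q: "subgroup Q G"
proof (rule subgroupI)
  show "Q \<subseteq> carrier G" using Q_carrier by blast
  have "\<one> \<in> Q"
    by (rule QI[of _ 1]) (use iterate_simps(5)[of 1] in simp_all)
  then show "Q \<noteq> {}" by blast
  show "inv x \<in> Q" if xQ: "x \<in> Q" for x
  proof -
    obtain a p where "0 < p" "(\<phi> ^^ p) ((\<phi> ^^ a) x) = (\<phi> ^^ a) x"
      using Q_common_period[OF xQ xQ] by blast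
    then have "(\<phi> ^^ a) (inv x) \<in> Q"
      using that by (intro QI[of _ p]) (simp_all add: Q_carrier)
    then show ?thesis using that by (simp add: iterate_in_Q_iff Q_carrier del: iterate_simps)
  qed
  show "x \<otimes> y \<in> Q" if xyQ: "x \<in> Q" "y \<in> Q" for x y
  proof -
    obtain a p where "0 < p" "(\<phi> ^^ p) ((\<phi> ^^ a) x) = (\<phi> ^^ a) x"
      "(\<phi> ^^ p) ((\<phi> ^^ a) y) = (\<phi> ^^ a) y"
      using Q_common_period[OF xyQ] by blast
    then have "(\<phi> ^^ a) (x \<otimes> y) \<in> Q"
      using that by (intro QI[of _ p]) (simp_all add: Q_carrier)
    then show ?thesis using that by (simp add: iterate_in_Q_iff Q_carrier del: iterate_simps)
  qed
qed

lemma nat_pow_in_core: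
  assumes "x \<in> core"
  shows "x [^] (k :: nat) \<in> core"
proof -
  let ?L = "(\<lambda>y. y [^] k) ` core"
  have "\<phi> (y [^] k) = \<phi> y [^] k" if "y \<in> core" for y
    using iterate_simps(4)[of y 1 k] core_carrier[OF that] by simp
  then have "\<phi> ` ?L = (\<lambda>y. y [^] k) ` (\<phi> ` core)"
    by (auto simp: image_image)
  then have "\<phi> ` ?L = ?L" by (simp add: image_surj_core)
  then show ?thesis
    using surj_core_greatest[of ?L "carrier G" \<phi>] assms core_carrier by blast
qed

lemma mult_in_core:
  assumes "x \<in> core" and "y \<in> core"
  shows "x \<otimes> y \<in> core"
proof -
  let ?L = "core <#> core"
  have "\<phi> ` ?L = \<phi> ` core <#> \<phi> ` core"
    by (intro set_mult_hom[OF endo] surj_core_subset)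
  then have "\<phi> ` ?L = ?L" by (simp add: image_surj_core)
  moreover have "?L \<subseteq> carrier G"
    by (intro setmult_subset_G surj_core_subset)
  ultimately have "?L \<subseteq> core"
    by (intro surj_core_greatest)
  moreover have "x \<otimes> y \<in> ?L"
    using assms unfolding set_mult_def by blast
  ultimately show ?thesis by (rule subsetD)
qed

lemma iterate_in_core: "x \<in> core \<Longrightarrow> (\<phi> ^^ n) x \<in> core"
proof (induction n)
  case (Suc n)
  then have "\<phi> ((\<phi> ^^ n) x) \<in> \<phi> ` core" by blast
  then show ?case by (simp add: image_surj_core)
qed simp

subsection \<open>Points without a quasi-periodic multiple\<close>

lemma iterate_eq_shift:
  assumes "x \<in> carrier G" and "(\<phi> ^^ i) x [^] (A :: nat) = x [^] (B :: nat)"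
  shows "(\<phi> ^^ i) ((\<phi> ^^ t) x) [^] A = (\<phi> ^^ t) x [^] B"
proof -
  have "(\<phi> ^^ t) ((\<phi> ^^ i) x [^] A) = (\<phi> ^^ t) (x [^] B)"
    using assms(2) by simp
  then show ?thesis
    using assms(1) by (simp add: iterate_commute[of t])
qed

text \<open>
  If \<open>\<phi> ^^ i\<close> acts on \<open>x\<close> like multiplication by \<open>B / A\<close>, then its \<open>n\<close>-th power acts like
  multiplication by \<open>(B / A) ^ n\<close>.  This brings relations for different powers of \<open>\<phi>\<close> to a common
  one.
\<close>

lemma iterate_eq_power:
  assumes x: "x \<in> carrier G" and eq: "(\<phi> ^^ i) x [^] (A :: nat) = x [^] (B :: nat)"
  shows "(\<phi> ^^ (n * i)) x [^] (A ^ n) = x [^] (B ^ n)"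
proof (induction n)
  case (Suc n)
  have "(\<phi> ^^ (Suc n * i)) x [^] (A ^ Suc n) = (\<phi> ^^ i) ((\<phi> ^^ (n * i)) x [^] (A ^ n)) [^] A"
    using x by (simp add: iterate_add nat_pow_pow mult.commute[of A])
  also have "\<dots> = ((\<phi> ^^ i) x [^] A) [^] (B ^ n)"
    using x by (simp add: Suc nat_pow_pow mult.commute[of A])
  also have "\<dots> = x [^] (B ^ Suc n)"
    using x by (simp add: eq nat_pow_pow)
  finally show ?case .
qed (use x in simp)

lemma nat_pow_one_if_nat_pow_eq:
  assumes "x \<in> carrier G" and "x [^] (m :: nat) = x [^] (n :: nat)" and "m \<noteq> n"
  shows "\<exists>k :: nat. 0 < k \<and> x [^] k = \<one>"
proof -
  have "\<exists>k :: nat. 0 < k \<and> x [^] k = \<one>" if "m < n" "x [^] m = x [^] n" for m n :: nat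
    using pow_eq_div2[OF assms(1) that(2)[symmetric]] that(1) by (intro exI[of _ "n - m"]) simp
  then show ?thesis
    using assms(2,3) by (metis linorder_neqE_nat)
qed

text \<open>
  When \<open>ns\<close> is finite, two of the points \<open>x [^] (p ^ a)\<close> have forward orbits that meet.  The point
  \<open>(\<phi> ^^ t) x\<close> is the earlier of the two iterates of \<open>x\<close> involved, so that only one side carries a
  further power of \<open>\<phi>\<close>.
\<close>

lemma power_family_collision:
  fixes p :: nat
  assumes fin: "ns (carrier G) \<phi> \<noteq> \<infinity>" and x: "x \<in> core" and "0 < p"
    and free: "\<And>k :: nat. 0 < k \<Longrightarrow> x [^] k \<notin> Q"
  obtains a b m t where "a \<noteq> b"
    and "(\<phi> ^^ m) ((\<phi> ^^ t) x) [^] (p ^ a) = (\<phi> ^^ t) x [^] (p ^ b)"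
proof -
  note xG = core_carrier[OF x]
  obtain a b i j where ab: "a \<noteq> b" and eq: "(\<phi> ^^ i) (x [^] (p ^ a)) = (\<phi> ^^ j) (x [^] (p ^ b))"
    using ns_infinite_if_disjoint_orbits[of "\<lambda>a. x [^] (p ^ a)" "carrier G" \<phi>]
      fin nat_pow_in_core[OF x] free \<open>0 < p\<close> by (metis zero_less_power)
  show thesis
  proof (cases "j \<le> i")
    case True
    then show ?thesis
      using that[of a b "i - j" j] ab eq xG by (simp add: iterate_add)
  next
    case False
    then show ?thesis
      using that[of b a "j - i" i] ab eq[symmetric] xG by (simp add: iterate_add)
  qed
qed

text \<open>
  Collisions in the families for \<open>2\<close> and for \<open>3\<close> make \<open>\<phi> ^^ m\<close> act on \<open>u\<close> like a power of \<open>2\<close> and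
  \<open>\<phi> ^^ n\<close> like a power of \<open>3\<close>.  Then \<open>\<phi> ^^ (n * m)\<close> acts like both, which is a torsion relation
  for \<open>u\<close>.
\<close>

lemma ns_infinite_if_no_multiple_in_Q:
  assumes x: "x \<in> core" and free: "\<And>k :: nat. 0 < k \<Longrightarrow> x [^] k \<notin> Q"
  shows "ns (carrier G) \<phi> = \<infinity>"
proof (rule ccontr)
  assume fin: "ns (carrier G) \<phi> \<noteq> \<infinity>"
  note xG = core_carrier[OF x]
  obtain a b m s where ab: "a \<noteq> b"
    and two: "(\<phi> ^^ m) ((\<phi> ^^ s) x) [^] (2 ^ a :: nat) = (\<phi> ^^ s) x [^] (2 ^ b :: nat)"
    using power_family_collision[OF fin x _ free, of 2] by (metis zero_less_numeral)
  obtain c d n t where cd: "c \<noteq> d"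
    and three: "(\<phi> ^^ n) ((\<phi> ^^ t) x) [^] (3 ^ c :: nat) = (\<phi> ^^ t) x [^] (3 ^ d :: nat)"
    using power_family_collision[OF fin x _ free, of 3] by (metis zero_less_numeral)
  define u where "u = (\<phi> ^^ (s + t)) x"
  have u: "u \<in> carrier G" unfolding u_def using xG by simp
  have st: "(\<phi> ^^ t) ((\<phi> ^^ s) x) = u" "(\<phi> ^^ s) ((\<phi> ^^ t) x) = u"
    by (simp_all add: u_def iterate_add add.commute)
  have two': "(\<phi> ^^ m) u [^] (2 ^ a :: nat) = u [^] (2 ^ b :: nat)"
    using iterate_eq_shift[OF iterate_simps(1)[OF xG] two, of t] by (simp only: st)
  have three': "(\<phi> ^^ n) u [^] (3 ^ c :: nat) = u [^] (3 ^ d :: nat)"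
    using iterate_eq_shift[OF iterate_simps(1)[OF xG] three, of s] by (simp only: st)
  \<comment> \<open>For \<open>m = 0\<close> the common power would be trivial in both relations, but then the first relation
    already is one between two multiples of \<open>u\<close>.\<close>
  have "\<exists>M N :: nat. M \<noteq> N \<and> u [^] M = u [^] N"
  proof (cases "m = 0")
    case True
    then show ?thesis
      using two' ab by (intro exI[of _ "2 ^ a"] exI[of _ "2 ^ b"]) simp
  next
    case False
    define v where "v = (\<phi> ^^ (n * m)) u"
    have v: "v \<in> carrier G" unfolding v_def using u by simp
    have v2: "v [^] ((2 ^ a :: nat) ^ n) = u [^] ((2 ^ b :: nat) ^ n)"
      using iterate_eq_power[OF u two', of n] by (simp add: v_def)
    have v3: "v [^] ((3 ^ c :: nat) ^ m) = u [^] ((3 ^ d :: nat) ^ m)"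
      using iterate_eq_power[OF u three', of m] by (simp add: v_def mult.commute)
    have "u [^] ((2 ^ b :: nat) ^ n * (3 ^ c) ^ m) = (v [^] ((2 ^ a :: nat) ^ n)) [^] ((3 ^ c :: nat) ^ m)"
      using u v by (simp only: v2 nat_pow_pow)
    also have "\<dots> = (v [^] ((3 ^ c :: nat) ^ m)) [^] ((2 ^ a :: nat) ^ n)"
      using v by (simp only: nat_pow_pow mult.commute)
    also have "\<dots> = u [^] ((3 ^ d :: nat) ^ m * (2 ^ a) ^ n)"
      using u by (simp only: v3 nat_pow_pow)
    finally have eq: "u [^] ((2 :: nat) ^ (b * n) * 3 ^ (c * m)) = u [^] ((2 :: nat) ^ (a * n) * 3 ^ (d * m))"
      by (simp add: power_mult mult.commute)
    have "(2 :: nat) ^ (b * n) * 3 ^ (c * m) \<noteq> 2 ^ (a * n) * 3 ^ (d * m)"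
    proof
      assume "(2 :: nat) ^ (b * n) * 3 ^ (c * m) = 2 ^ (a * n) * 3 ^ (d * m)"
      then have "c * m = d * m"
        using three_exponent_le by (metis le_antisym)
      with cd False show False by simp
    qed
    with eq show ?thesis by blast
  qed
  then obtain k :: nat where k: "0 < k" "u [^] k = \<one>"
    using nat_pow_one_if_nat_pow_eq[OF u] by blast
  have "(\<phi> ^^ (s + t)) (x [^] k) \<in> Q"
    using k(2) xG subgroup.one_closed[OF subgroup_Q] by (simp add: u_def)
  then have "x [^] k \<in> Q"
    using iterate_in_Q_iff[of "x [^] k" "s + t"] xG by blast
  with free k(1) show False by blast
qed


subsection \<open>Points with a quasi-periodic multiple\<close>

text \<open>
  Write the group additively and let \<open>u\<close> be an iterate of \<open>x\<close> so late that \<open>N u\<close> and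
  \<open>\<phi>\<^sup>m u - u\<close> are truly periodic, with common period \<open>p\<close>.  For \<open>r = m p\<close> the difference
  \<open>w = \<phi>\<^sup>r u - u\<close> is a sum of iterates of \<open>\<phi>\<^sup>m u - u\<close>, so it is fixed by \<open>\<phi>\<^sup>p\<close> and by \<open>\<phi>\<^sup>r\<close>.
  Therefore \<open>\<phi>\<^sup>r\<close> moves \<open>u\<close> along an arithmetic progression with step \<open>w\<close>.  Torsion enters here:
  \<open>N w = \<phi>\<^sup>r (N u) - N u = 0\<close>, so the progression closes up after \<open>N\<close> steps.
\<close>

lemma Q_if_return_mod_Q:
  assumes x: "x \<in> carrier G" and "0 < N" and "x [^] (N :: nat) \<in> Q"
    and "0 < m" and "(\<phi> ^^ m) x \<otimes> inv x \<in> Q"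
  shows "x \<in> Q"
proof -
  obtain a p where p: "0 < p"
    and pN: "(\<phi> ^^ p) ((\<phi> ^^ a) (x [^] N)) = (\<phi> ^^ a) (x [^] N)"
    and py: "(\<phi> ^^ p) ((\<phi> ^^ a) ((\<phi> ^^ m) x \<otimes> inv x)) = (\<phi> ^^ a) ((\<phi> ^^ m) x \<otimes> inv x)"
    using Q_common_period[OF assms(3,5)] by blast
  define u where "u = (\<phi> ^^ a) x"
  have u: "u \<in> carrier G" unfolding u_def using x by simp
  have uN: "(\<phi> ^^ p) (u [^] N) = u [^] N"
    using pN x by (simp add: u_def)
  have uy: "(\<phi> ^^ p) ((\<phi> ^^ m) u \<otimes> inv u) = (\<phi> ^^ m) u \<otimes> inv u"
  proof -
    have "(\<phi> ^^ a) ((\<phi> ^^ m) x \<otimes> inv x) = (\<phi> ^^ m) u \<otimes> inv u"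
      using x by (simp add: u_def iterate_commute[of m a])
    with py show ?thesis by (simp only:)
  qed
  have fixed: "(\<phi> ^^ p) ((\<phi> ^^ (m * k)) u \<otimes> inv u) = (\<phi> ^^ (m * k)) u \<otimes> inv u" for k
  proof (induction k)
    case 0
    show ?case using u by simp
  next
    case (Suc k)
    \<comment> \<open>a telescoping sum, peeled off at the far end\<close>
    have split: "(\<phi> ^^ (m * Suc k)) u \<otimes> inv u
        = (\<phi> ^^ (m * k)) ((\<phi> ^^ m) u \<otimes> inv u) \<otimes> ((\<phi> ^^ (m * k)) u \<otimes> inv u)"
    proof -
      have "inv ((\<phi> ^^ (m * k)) u) \<otimes> ((\<phi> ^^ (m * k)) u \<otimes> inv u) = inv u"
        using u by (simp add: m_assoc[symmetric])
      then show ?thesis using u by (simp add: m_assoc iterate_add add.commute)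
    qed
    have "(\<phi> ^^ p) ((\<phi> ^^ (m * k)) ((\<phi> ^^ m) u \<otimes> inv u)) = (\<phi> ^^ (m * k)) ((\<phi> ^^ m) u \<otimes> inv u)"
      by (subst iterate_commute) (simp only: uy)
    then show ?case
      unfolding split using Suc u
      by (subst group_hom.hom_mult[OF iterate_group_hom]) simp_all
  qed
  define r where "r = m * p"
  define w where "w = (\<phi> ^^ r) u \<otimes> inv u"
  have w: "w \<in> carrier G" unfolding w_def using u by simp
  have rw: "(\<phi> ^^ r) w = w"
    using periodic_mult[OF fixed[of p], of m] by (simp add: r_def w_def mult.commute)
  have step: "(\<phi> ^^ r) u = w \<otimes> u"
    using u by (simp add: w_def m_assoc)
  have drift: "(\<phi> ^^ (r * k)) u = w [^] k \<otimes> u" for k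
  proof (induction k)
    case (Suc k)
    have "(\<phi> ^^ (r * Suc k)) u = (\<phi> ^^ r) ((\<phi> ^^ (r * k)) u)"
      by (simp add: iterate_add)
    also have "\<dots> = w [^] Suc k \<otimes> u"
      using u w by (simp add: Suc rw step m_assoc)
    finally show ?case .
  qed (use u in simp)
  have "w [^] N = (\<phi> ^^ r) (u [^] N) \<otimes> inv (u [^] N)"
    using u by (simp add: w_def nat_pow_distrib nat_pow_inv)
  also have "\<dots> = \<one>"
    using periodic_mult[OF uN, of m] u by (simp add: r_def mult.commute del: iterate_simps)
  finally have "(\<phi> ^^ (r * N)) u = u"
    using drift[of N] u by simp
  then have "u \<in> Q"
    using QI[of u "r * N"] u p \<open>0 < m\<close> \<open>0 < N\<close> by (simp add: r_def)
  then show ?thesis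
    using x by (simp add: u_def iterate_in_Q_iff)
qed

text \<open>
  The subgroup generated by \<open>Q\<close> and the first \<open>d\<close> points of the orbit.  Adjoining the points one
  at a time lets its elements be peeled by induction on \<open>d\<close>.
\<close>

primrec orbit_span :: "'a \<Rightarrow> nat \<Rightarrow> 'a set" where
  "orbit_span x 0 = Q"
| "orbit_span x (Suc d) = orbit_span x d <#> generate G {(\<phi> ^^ d) x}"

lemma subgroup_orbit_span:
  assumes "x \<in> carrier G"
  shows "subgroup (orbit_span x d) G"
proof (induction d)
  case (Suc d)
  then show ?case using assms by (simp add: mult_subgroups generate_is_subgroup)
qed (simp add: subgroup_Q)

lemma mem_orbit_span_Suc:
  assumes "x \<in> carrier G"
  shows "y \<in> orbit_span x (Suc d) \<longleftrightarrow> (\<exists>s\<in>orbit_span x d. \<exists>c :: int. y = s \<otimes> (\<phi> ^^ d) x [^] c)"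
proof -
  have gen: "generate G {(\<phi> ^^ d) x} = {(\<phi> ^^ d) x [^] (c :: int) | c. c \<in> UNIV}"
    using assms by (intro generate_pow) simp
  show ?thesis
    unfolding orbit_span.simps set_mult_def gen by blast
qed

lemma orbit_span_mono:
  assumes x: "x \<in> carrier G" and "d \<le> e"
  shows "orbit_span x d \<subseteq> orbit_span x e"
proof (rule lift_Suc_mono_le[OF _ \<open>d \<le> e\<close>])
  show "orbit_span x n \<subseteq> orbit_span x (Suc n)" for n
  proof
    fix s assume s: "s \<in> orbit_span x n"
    then have "s = s \<otimes> (\<phi> ^^ n) x [^] (0 :: int)"
      using subgroup.mem_carrier[OF subgroup_orbit_span[OF x]] by simp
    with s show "s \<in> orbit_span x (Suc n)"
      unfolding mem_orbit_span_Suc[OF x] by blast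
  qed
qed

lemma iterate_in_orbit_span:
  assumes x: "x \<in> carrier G" and "i < d"
  shows "(\<phi> ^^ i) x \<in> orbit_span x d"
proof -
  have "(\<phi> ^^ i) x = \<one> \<otimes> (\<phi> ^^ i) x [^] (1 :: int)"
    using x by (simp add: int_pow_1)
  then have "(\<phi> ^^ i) x \<in> orbit_span x (Suc i)"
    unfolding mem_orbit_span_Suc[OF x] using subgroup.one_closed[OF subgroup_orbit_span[OF x]] by blast
  then show ?thesis
    using orbit_span_mono[OF x, of "Suc i" d] \<open>i < d\<close> by auto
qed

lemma endo_orbit_span:
  assumes x: "x \<in> carrier G"
  shows "y \<in> orbit_span x d \<Longrightarrow> \<phi> y \<in> orbit_span x (Suc d)"
proof (induction d arbitrary: y)
  case 0
  then have "\<phi> y \<in> Q"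
    using iterate_in_Q_iff[of y 1] Q_carrier[of y] by simp
  then show ?case
    using orbit_span_mono[OF x, of 0 1] by auto
next
  case (Suc d)
  then obtain s and c :: int where s: "s \<in> orbit_span x d" "y = s \<otimes> (\<phi> ^^ d) x [^] c"
    unfolding mem_orbit_span_Suc[OF x] by blast
  have "s \<in> carrier G"
    using s(1) subgroup.mem_carrier[OF subgroup_orbit_span[OF x]] by blast
  then have "\<phi> y = \<phi> s \<otimes> (\<phi> ^^ Suc d) x [^] c"
    using iterate_simps(2)[of s "(\<phi> ^^ d) x [^] c" 1] iterate_simps(6)[of "(\<phi> ^^ d) x" 1 c] x
    by (simp add: s(2) del: iterate_simps(6)) 
  then show ?case
    using Suc.IH[OF s(1)] unfolding mem_orbit_span_Suc[OF x, of _ "Suc d"] by blast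
qed

text \<open>
  All iterates of \<open>x\<close> have order dividing \<open>N\<close> modulo \<open>Q\<close>, so coefficients in \<open>{0..<N}\<close> suffice.
\<close>

lemma finite_orbit_span_mod_Q:
  assumes x: "x \<in> carrier G" and "0 < N" and N: "x [^] (N :: nat) \<in> Q"
  shows "\<exists>T. finite T \<and> T \<subseteq> carrier G \<and> (\<forall>y\<in>orbit_span x d. \<exists>t\<in>T. y \<otimes> inv t \<in> Q)"
proof (induction d)
  case 0
  show ?case
    by (rule exI[of _ "{\<one>}"]) (auto simp: Q_carrier)
next
  case (Suc d)
  then obtain T where T: "finite T" "T \<subseteq> carrier G" "\<And>y. y \<in> orbit_span x d \<Longrightarrow> \<exists>t\<in>T. y \<otimes> inv t \<in> Q"
    by blast
  let ?x = "(\<phi> ^^ d) x"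
  let ?T = "(\<lambda>(t, c). t \<otimes> ?x [^] c) ` (T \<times> {0..<int N})"
  have "\<exists>t\<in>?T. y \<otimes> inv t \<in> Q" if y: "y \<in> orbit_span x (Suc d)" for y
  proof -
    obtain s and c :: int where s: "s \<in> orbit_span x d" "y = s \<otimes> ?x [^] c"
      using y unfolding mem_orbit_span_Suc[OF x] by blast
    obtain t where t: "t \<in> T" "s \<otimes> inv t \<in> Q" using T(3)[OF s(1)] by blast
    have sG: "s \<in> carrier G" and tG: "t \<in> carrier G"
      using s(1) subgroup.mem_carrier[OF subgroup_orbit_span[OF x]] t(1) T(2) by auto
    let ?r = "c mod int N"
    have "(\<phi> ^^ d) (x [^] N) \<in> Q"
      using iterate_in_Q_iff[of "x [^] N" d] x N by blast
    then have "(?x [^] N) [^] (c div int N) \<in> Q"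
      using subgroup_int_pow_closed[OF subgroup_Q] x by simp
    moreover have "(?x [^] N) [^] (c div int N) = ?x [^] c \<otimes> inv (?x [^] ?r)"
    proof -
      have "(?x [^] N) [^] (c div int N) = ?x [^] (int N * (c div int N))"
        using x by (simp add: int_pow_pow int_pow_int[symmetric])
      also have "int N * (c div int N) = c - ?r"
        by (simp add: minus_mod_eq_mult_div)
      finally show ?thesis using x by (simp add: int_pow_diff)
    qed
    ultimately have "(s \<otimes> inv t) \<otimes> (?x [^] c \<otimes> inv (?x [^] ?r)) \<in> Q"
      using subgroup.m_closed[OF subgroup_Q t(2)] by simp
    moreover have "y \<otimes> inv (t \<otimes> ?x [^] ?r) = (s \<otimes> inv t) \<otimes> (?x [^] c \<otimes> inv (?x [^] ?r))"
      using sG tG x by (simp add: s(2) inv_mult m_ac)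
    ultimately have "y \<otimes> inv (t \<otimes> ?x [^] ?r) \<in> Q" by simp
    moreover have "t \<otimes> ?x [^] ?r \<in> ?T"
      using t(1) \<open>0 < N\<close> by (intro image_eqI[of _ _ "(t, ?r)"]) simp_all
    ultimately show ?thesis by blast
  qed
  moreover have "finite ?T" "?T \<subseteq> carrier G"
    using T(1,2) x by auto
  ultimately show ?case by blast
qed

text \<open>
  A dependent iterate makes the span invariant under \<open>\<phi>\<close>, so the whole orbit runs inside a
  subgroup that is finite modulo \<open>Q\<close>.  By pigeonhole two iterates agree modulo \<open>Q\<close>; since \<open>Q\<close> is
  closed under preimages, the earlier one can be shifted back to \<open>x\<close> itself.
\<close>

lemma iterate_notin_orbit_span:
  assumes x: "x \<in> carrier G" and "x \<notin> Q" and "0 < N" and N: "x [^] (N :: nat) \<in> Q"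
  shows "(\<phi> ^^ d) x \<notin> orbit_span x d"
proof
  assume dep: "(\<phi> ^^ d) x \<in> orbit_span x d"
  note sub = subgroup_orbit_span[OF x]
  have "orbit_span x (Suc d) \<subseteq> orbit_span x d"
    using subgroup.m_closed[OF sub] subgroup_int_pow_closed[OF sub dep]
    unfolding mem_orbit_span_Suc[OF x] subset_iff by metis
  then have inv: "\<phi> y \<in> orbit_span x d" if "y \<in> orbit_span x d" for y
    using endo_orbit_span[OF x that] by blast
  have "x \<in> orbit_span x d"
    \<comment> \<open>for \<open>d = 0\<close> this is the assumed dependency\<close>
    using dep iterate_in_orbit_span[OF x, of 0 d] by (cases d) auto
  then have orbit: "(\<phi> ^^ n) x \<in> orbit_span x d" for n
    by (induction n) (auto simp: inv)
  obtain T where T: "finite T" "T \<subseteq> carrier G" "\<forall>y\<in>orbit_span x d. \<exists>t\<in>T. y \<otimes> inv t \<in> Q"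
    using finite_orbit_span_mod_Q[OF x \<open>0 < N\<close> N] by blast
  have "\<forall>n. \<exists>t. t \<in> T \<and> (\<phi> ^^ n) x \<otimes> inv t \<in> Q"
    using T(3) orbit by blast
  then obtain t where "\<forall>n. t n \<in> T \<and> (\<phi> ^^ n) x \<otimes> inv (t n) \<in> Q"
    by (rule choice[THEN exE])
  then have t: "\<And>n. t n \<in> T" "\<And>n. (\<phi> ^^ n) x \<otimes> inv (t n) \<in> Q"
    by blast+
  have "finite (range t)"
    using T(1) t(1) by (meson finite_subset image_subsetI)
  then have "\<not> inj t" using finite_imageD infinite_UNIV_nat by blast
  then obtain i j where ij: "i < j" "t i = t j"
    unfolding inj_def by (metis linorder_neqE_nat)
  have ti: "t i \<in> carrier G" using t(1) T(2) by blast
  have "((\<phi> ^^ j) x \<otimes> inv (t i)) \<otimes> inv ((\<phi> ^^ i) x \<otimes> inv (t i)) \<in> Q"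
    using t(2)[of i] t(2)[of j] ij(2)
    by (simp add: subgroup.m_closed[OF subgroup_Q] subgroup.m_inv_closed[OF subgroup_Q])
  also have "((\<phi> ^^ j) x \<otimes> inv (t i)) \<otimes> inv ((\<phi> ^^ i) x \<otimes> inv (t i)) = (\<phi> ^^ j) x \<otimes> inv ((\<phi> ^^ i) x)"
  proof -
    have "inv (t i) \<otimes> (inv ((\<phi> ^^ i) x) \<otimes> t i) = inv ((\<phi> ^^ i) x)"
      using ti x m_comm[of "inv ((\<phi> ^^ i) x)" "t i"] by (simp add: m_assoc[symmetric])
    then show ?thesis using ti x by (simp add: inv_mult m_assoc)
  qed
  also have "\<dots> = (\<phi> ^^ i) ((\<phi> ^^ (j - i)) x \<otimes> inv x)"
    using ij(1) x by (simp add: iterate_add)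
  finally have "(\<phi> ^^ (j - i)) x \<otimes> inv x \<in> Q"
    using iterate_in_Q_iff[of "(\<phi> ^^ (j - i)) x \<otimes> inv x" i] x by simp
  then show False
    using Q_if_return_mod_Q[OF x \<open>0 < N\<close> N, of "j - i"] ij(1) \<open>x \<notin> Q\<close> by simp
qed

text \<open>
  The iterates of \<open>x \<otimes> (\<phi> ^^ k) x\<close> are the products of two iterates of \<open>x\<close> at distance \<open>k\<close>.  In an
  equality between two such products the iterate of largest index would be a combination of
  earlier ones, unless the largest indices agree; after cancelling, the same applies to the
  smaller indices.
\<close>

lemma ns_infinite_if_multiple_in_Q:
  assumes x: "x \<in> core" "x \<notin> Q" and N: "0 < N" "x [^] (N :: nat) \<in> Q"
  shows "ns (carrier G) \<phi> = \<infinity>"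
proof -
  note xG = core_carrier[OF x(1)]
  note sub = subgroup_orbit_span[OF xG]
  note indep = iterate_notin_orbit_span[OF xG x(2) N]
  let ?x = "\<lambda>n. (\<phi> ^^ n) x"
  have top: "u \<otimes> ?x d \<notin> orbit_span x d" if "u \<in> orbit_span x d" for u d
  proof
    assume "u \<otimes> ?x d \<in> orbit_span x d"
    then have "inv u \<otimes> (u \<otimes> ?x d) \<in> orbit_span x d"
      using that by (simp add: subgroup.m_closed[OF sub] subgroup.m_inv_closed[OF sub])
    moreover have "inv u \<otimes> (u \<otimes> ?x d) = ?x d"
      using subgroup.mem_carrier[OF sub that] xG by (simp add: m_assoc[symmetric])
    ultimately show False using indep by simp
  qed
  have sums: "?x i \<otimes> ?x k \<noteq> ?x j \<otimes> ?x l" if "i < k" "j < l" "k < l" for i j k l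
    using top[of "?x j" l] that
    by (metis iterate_in_orbit_span[OF xG] subgroup.m_closed[OF sub] less_trans)
  have inj: "?x i \<noteq> ?x j" if "i < j" for i j
    using indep[of j] iterate_in_orbit_span[OF xG that] by metis
  have apart: "?x i \<otimes> ?x k \<noteq> ?x j \<otimes> ?x l" if "i < k" "j < l" "(i, k) \<noteq> (j, l)" for i j k l
  proof (cases "k = l")
    case True
    then have "?x i \<noteq> ?x j" using that inj[of i j] inj[of j i] by (metis linorder_neqE_nat)
    then show ?thesis using True xG by simp
  next
    case False
    then show ?thesis using sums[of i k j l] sums[of j l i k] that by (metis linorder_neqE_nat)
  qed
  show ?thesis
  proof (rule ns_infinite_if_disjoint_orbits[of "\<lambda>k. x \<otimes> ?x (Suc k)"])
    show "x \<otimes> ?x (Suc k) \<in> core" for k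
      using mult_in_core iterate_in_core x(1) by blast
    show "x \<otimes> ?x (Suc k) \<notin> Q" for k
      using top[of x "Suc k"] iterate_in_orbit_span[OF xG, of 0 "Suc k"]
        orbit_span_mono[OF xG, of 0 "Suc k"] by auto
    fix a b i j :: nat assume "a \<noteq> b"
    then have "?x i \<otimes> ?x (i + Suc a) \<noteq> ?x j \<otimes> ?x (j + Suc b)"
      by (intro apart) auto
    then show "(\<phi> ^^ i) (x \<otimes> ?x (Suc a)) \<noteq> (\<phi> ^^ j) (x \<otimes> ?x (Suc b))"
      using xG by (simp add: iterate_add del: funpow.simps)
  qed
qed

lemma ns_infinite_if_core_not_Q:
  assumes "\<not> core \<subseteq> Q"
  shows "ns (carrier G) \<phi> = \<infinity>"
proof -
  obtain x where x: "x \<in> core" "x \<notin> Q"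
    using assms by blast
  show ?thesis
  proof (cases "\<exists>N :: nat. 0 < N \<and> x [^] N \<in> Q")
    case True
    then show ?thesis using ns_infinite_if_multiple_in_Q[OF x] by blast
  next
    case False
    then show ?thesis using ns_infinite_if_no_multiple_in_Q[OF x(1)] by blast
  qed
qed

end

theorem mainTheorem2:
  fixes G :: "('a, 'b) monoid_scheme" and \<phi> :: "'a \<Rightarrow> 'a"
  assumes "comm_group G" and "\<phi> \<in> hom G G"
  shows "(ns (carrier G) \<phi> > 0 \<longleftrightarrow> ns (carrier G) \<phi> = \<infinity>) \<and>
         (ns (carrier G) \<phi> = \<infinity> \<longleftrightarrow> \<not> surj_core (carrier G) \<phi> \<subseteq> QPer (carrier G) \<phi>)"
proof -
  interpret abelian_endomorphism G \<phi>
    using assms by (intro abelian_endomorphism.intro abelian_endomorphism_axioms.intro)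
  have "ns (carrier G) \<phi> > 0 \<Longrightarrow> \<not> core \<subseteq> Q"
    by (rule ns_pos_imp_core_not_QPer[OF self_map])
  moreover have "ns (carrier G) \<phi> = \<infinity> \<Longrightarrow> ns (carrier G) \<phi> > 0"
    by simp
  ultimately show ?thesis
    using ns_infinite_if_core_not_Q by blast
qed

end
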